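(* Let $\Sigma\subset\mathbb{R}^3$ be a $K^{1/4}$-translator with speed $\vec{v}$ of translation type, parametrized by $X(x,y)=(x,y,f(x)+g(y))$, $x\in I$, $y\in J$, where $f\colon I\to\mathbb{R}$ and $g\colon J\to\mathbb{R}$ are smooth functions on intervals $I,J\subset\mathbb{R}$, and suppose that the Gauss curvature of $\Sigma$ is not constant. Up to a change of the roles of $f$ and $g$, the function $f$ is $f(x)=x^2/m+ax+b$ with $a,b,m\in\mathbb{R}$, $m\neq0$, and $g$ is one of the following functions depending on the speed $\vec{v}$: (1) If the speed is $\vec{v}=(0,0,1)$, then $g(y)=my^2/4+cy+d$, $c,d\in\mathbb{R}$. (2) If the speed is $\vec{v}=(0,1,v_3)$, then $$g(y)=\frac{v_3(2c+my)}{m}-\frac{\left(\frac32\right)^{2/3}(2c+my)^{2/3}}{m}+d,$$ where $c,d\in\mathbb{R}$.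
   Context: A smooth surface $\Sigma$ in Euclidean space $\mathbb{R}^3$ with unit normal $N$ and Gauss curvature $K$ is called a $K^{\alpha}$-translator with speed $\vec{v}\in\mathbb{R}^3$ if $K^{\alpha}=\langle N,\vec{v}\rangle$ on $\Sigma$; here $\alpha=1/4$, and it is implicitly assumed that $K^{1/4}$ makes sense. For the speed $\vec{v}=(0,1,v_3)$ the equation $K^{1/4}=\langle N,\vec{v}\rangle$ is taken with this vector as written (it is not normalized to unit length). Planes and surfaces of constant Gauss curvature are discarded throughout. A surface of translation type is the sum of two curves contained in two coordinate planes, $\gamma(x)=(x,0,f(x))$ and $\beta(y)=(0,y,g(y))$, i.e. the graph $z=f(x)+g(y)$; for it, with unit normal $N=(-f',-g',1)/\sqrt{1+f'^2+g'^2}$ and $\vec{v}=(v_1,v_2,v_3)$, the translator equation for $\alpha=1/4$ reads $(f''(x)g''(y))^{1/4}=v_3-v_1f'(x)-v_2g'(y)$. "Up to a change of the roles of $f$ and $g$" means up to interchanging $(x,f,v_1)$ with $(y,g,v_2)$. *)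

theory Defs
  imports "HOL-Analysis.Analysis"
begin

text \<open>Derivatives are taken within the parameter interval, so that they are one-sided at an
  end point belonging to it. The intervals are always nondegenerate.\<close>

definition smooth_fun_on :: "(real \<Rightarrow> real) \<Rightarrow> real set \<Rightarrow> bool" where
  "smooth_fun_on f I \<longleftrightarrow>
     (\<exists>D :: nat \<Rightarrow> real \<Rightarrow> real. (\<forall>x\<in>I. D 0 x = f x) \<and>
        (\<forall>n. \<forall>x\<in>I. (D n has_real_derivative D (Suc n) x) (at x within I)))"

definition nondegenerate_interval :: "real set \<Rightarrow> bool" where
  "nondegenerate_interval I \<longleftrightarrow> is_interval I \<and> interior I \<noteq> {}"

text \<open>A parametrized surface is a map \<open>X\<close> of two real variables, the first ranging over \<open>I\<close> and
  the second over \<open>J\<close>.\<close>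

definition partial1 :: "real set \<Rightarrow> (real \<Rightarrow> real \<Rightarrow> real^3) \<Rightarrow> real \<Rightarrow> real \<Rightarrow> real^3" where
  "partial1 I X x y = vector_derivative (\<lambda>s. X s y) (at x within I)"

definition partial2 :: "real set \<Rightarrow> (real \<Rightarrow> real \<Rightarrow> real^3) \<Rightarrow> real \<Rightarrow> real \<Rightarrow> real^3" where
  "partial2 J X x y = vector_derivative (\<lambda>t. X x t) (at y within J)"

text \<open>The orientation is the one given by the parametrization: for a graph over the
  \<open>xy\<close>-plane the unit normal points upwards.\<close>

definition unit_normal ::
  "real set \<Rightarrow> real set \<Rightarrow> (real \<Rightarrow> real \<Rightarrow> real^3) \<Rightarrow> real \<Rightarrow> real \<Rightarrow> real^3" where
  "unit_normal I J X x y =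
     (let n = cross3 (partial1 I X x y) (partial2 J X x y) in (1 / norm n) *\<^sub>R n)"

text \<open>Quotient of the determinants of the second and the first fundamental form.\<close>

definition gauss_curvature ::
  "real set \<Rightarrow> real set \<Rightarrow> (real \<Rightarrow> real \<Rightarrow> real^3) \<Rightarrow> real \<Rightarrow> real \<Rightarrow> real" where
  "gauss_curvature I J X x y =
     (let X1 = partial1 I X; X2 = partial2 J X; N = unit_normal I J X x y;
          E = X1 x y \<bullet> X1 x y; F = X1 x y \<bullet> X2 x y; G = X2 x y \<bullet> X2 x y;
          h11 = N \<bullet> partial1 I X1 x y; h12 = N \<bullet> partial2 J X1 x y; h22 = N \<bullet> partial2 J X2 x y
      in (h11 * h22 - h12\<^sup>2) / (E * G - F\<^sup>2))"

text \<open>For \<open>\<alpha> > 0\<close>; the condition \<open>K \<ge> 0\<close> says that \<open>K\<^sup>\<alpha>\<close> makes sense (and \<open>0 powr \<alpha> = 0\<close>).\<close>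

definition K_translator ::
  "real \<Rightarrow> real set \<Rightarrow> real set \<Rightarrow> (real \<Rightarrow> real \<Rightarrow> real^3) \<Rightarrow> real^3 \<Rightarrow> bool" where
  "K_translator \<alpha> I J X v \<longleftrightarrow>
     (\<forall>x\<in>I. \<forall>y\<in>J. 0 \<le> gauss_curvature I J X x y \<and>
        gauss_curvature I J X x y powr \<alpha> = unit_normal I J X x y \<bullet> v)"

definition translation_surface ::
  "(real \<Rightarrow> real) \<Rightarrow> (real \<Rightarrow> real) \<Rightarrow> real \<Rightarrow> real \<Rightarrow> real^3" where
  "translation_surface f g x y = vector [x, y, f x + g y]"

end

theory Submission
  imports Defs
begin

text \<open>For the graph of \<open>f x + g y\<close> put \<open>W\<^sup>2 = 1 + f'\<^sup>2 + g'\<^sup>2\<close>. The Gauss curvature is \<open>f'' g'' / W\<^sup>4\<close> and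
  the upward unit normal is \<open>(-f', -g', 1) / W\<close>, so for the exponent 1/4 all powers of \<open>W\<close> cancel in
  the translator equation. It becomes \<open>f''(x) g''(y) = P(x, y)\<^sup>4\<close>, where
  \<open>P(x, y) = v3 - v1 f'(x) - v2 g'(y) \<ge> 0\<close> (\<open>translation_translator_equation\<close>).

  The left-hand side is a product of a function of \<open>x\<close> and a function of \<open>y\<close>, while \<open>P\<close> is a sum of
  such functions. The values of such a product at \<open>(x, y)\<close> and \<open>(x', y')\<close> multiply to the same number
  as those at \<open>(x, y')\<close> and \<open>(x', y)\<close>. Since \<open>P \<ge> 0\<close>, fourth roots may be taken, and
  \<open>P(x, y) P(x', y') = P(x, y') P(x', y)\<close>. For a sum this says that
  \<open>v1 (f'(x) - f'(x')) v2 (g'(y) - g'(y')) = 0\<close>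
  (\<open>product_eq_fourth_power_of_sum_imp_constant\<close>). If \<open>v1\<close> and \<open>v2\<close> were both nonzero, then \<open>f'\<close>
  or \<open>g'\<close> would be constant and the curvature would vanish identically. So one of them is 0, and
  by symmetry it may be taken to be \<open>v1\<close>.

  Then \<open>f''(x) g''(y) = (v3 - v2 g'(y))\<^sup>4\<close>. At some \<open>y\<close> the right-hand side is nonzero, hence \<open>f''\<close> is
  a nonzero constant \<open>2/m\<close>, and \<open>f\<close> is a quadratic polynomial. If \<open>v = (0, 0, 1)\<close>, then also
  \<open>g'' = m/2\<close> is constant. If \<open>v = (0, 1, v3)\<close>, then \<open>h = v3 - g'\<close> satisfies \<open>h' = - (m/2) h\<^sup>4\<close>. The
  function \<open>h\<close> has no zeros, because a solution with a zero vanishes identically. Therefore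
  \<open>(1 / h\<^sup>3)' = 3 m / 2\<close>, so \<open>1 / h\<^sup>3\<close> is an affine function, and integrating \<open>g' = v3 - h\<close> gives the
  power 2/3 (\<open>profile_of_quartic_ode\<close>).\<close>

section \<open>The curvature of a surface of translation type\<close>

lemma nondegenerate_interval_at_within_neq_bot:
  assumes "nondegenerate_interval I" and "x \<in> I"
  shows "at x within I \<noteq> bot"
proof -
  have "I \<noteq> {z}" for z
    using assms(1) by (auto simp: nondegenerate_interval_def)
  moreover have "connected I"
    using assms(1) by (simp add: nondegenerate_interval_def is_interval_connected)
  ultimately have "x islimpt I"
    using assms(2) by (intro connected_imp_perfect)
  then show ?thesis
    by (simp add: trivial_limit_within)
qed

text \<open>The partial derivatives are defined by choice, hence determined only where a limit within the
  interval is unique. The hypothesis that \<open>w\<close> agrees with \<open>u\<close> on \<open>I\<close> alone is what second partial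
  derivatives require: the first ones are known only on the parameter interval.\<close>

lemma vector_derivative_within_eqI:
  assumes "nondegenerate_interval I" and "x \<in> I"
    and "(u has_vector_derivative u') (at x within I)"
    and "\<And>s. s \<in> I \<Longrightarrow> w s = u s"
  shows "vector_derivative w (at x within I) = u'"
proof -
  have "(w has_vector_derivative u') (at x within I)"
    using has_vector_derivative_transform[OF assms(2) _ assms(3), of w] assms(4) by simp
  then show ?thesis
    using vector_derivative_within[OF nondegenerate_interval_at_within_neq_bot[OF assms(1,2)]] by blast
qed

lemma has_vector_derivative_vector_3:
  fixes a b c :: "real \<Rightarrow> real"
  assumes "(a has_real_derivative a') F" "(b has_real_derivative b') F"
    "(c has_real_derivative c') F"
  shows "((\<lambda>s. vector [a s, b s, c s] :: real^3) has_vector_derivative vector [a', b', c']) F"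
proof -
  have eq: "vector [r, s, t] = r *\<^sub>R (vector [1, 0, 0] :: real^3) + s *\<^sub>R vector [0, 1, 0]
      + t *\<^sub>R vector [0, 0, 1]" for r s t :: real
    by (simp add: vec_eq_iff forall_3 vector_3)
  have "((\<lambda>s. a s *\<^sub>R (vector [1, 0, 0] :: real^3) + b s *\<^sub>R vector [0, 1, 0]
      + c s *\<^sub>R vector [0, 0, 1]) has_vector_derivative
      a' *\<^sub>R vector [1, 0, 0] + b' *\<^sub>R vector [0, 1, 0] + c' *\<^sub>R vector [0, 0, 1]) F"
    using assms unfolding has_real_derivative_iff_has_vector_derivative
    by (intro has_vector_derivative_add
        bounded_linear.has_vector_derivative[OF bounded_linear_scaleR_left])
  then show ?thesis
    by (simp only: eq[symmetric])
qed

lemma partials_translation_surface: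
  assumes I: "nondegenerate_interval I" and J: "nondegenerate_interval J"
    and f1: "\<And>x. x \<in> I \<Longrightarrow> (f has_real_derivative f1 x) (at x within I)"
    and f2: "\<And>x. x \<in> I \<Longrightarrow> (f1 has_real_derivative f2 x) (at x within I)"
    and g1: "\<And>y. y \<in> J \<Longrightarrow> (g has_real_derivative g1 y) (at y within J)"
    and g2: "\<And>y. y \<in> J \<Longrightarrow> (g1 has_real_derivative g2 y) (at y within J)"
    and x: "x \<in> I" and y: "y \<in> J"
  defines "X \<equiv> translation_surface f g"
  shows "partial1 I X x y = vector [1, 0, f1 x]"
    and "partial2 J X x y = vector [0, 1, g1 y]"
    and "partial1 I (partial1 I X) x y = vector [0, 0, f2 x]"
    and "partial2 J (partial1 I X) x y = vector [0, 0, 0]"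
    and "partial2 J (partial2 J X) x y = vector [0, 0, g2 y]"
proof -
  have X1: "partial1 I X s t = vector [1, 0, f1 s]" if "s \<in> I" for s t
    unfolding partial1_def X_def translation_surface_def
    by (rule vector_derivative_within_eqI[OF I that], rule has_vector_derivative_vector_3)
      (auto intro!: derivative_eq_intros f1 that)
  have X2: "partial2 J X s t = vector [0, 1, g1 t]" if "t \<in> J" for s t
    unfolding partial2_def X_def translation_surface_def
    by (rule vector_derivative_within_eqI[OF J that], rule has_vector_derivative_vector_3)
      (auto intro!: derivative_eq_intros g1 that)
  show "partial1 I X x y = vector [1, 0, f1 x]" "partial2 J X x y = vector [0, 1, g1 y]"
    using X1 X2 x y by auto
  show "partial1 I (partial1 I X) x y = vector [0, 0, f2 x]"
    unfolding partial1_def[of I "partial1 I X"]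
    by (rule vector_derivative_within_eqI[OF I x _ X1], rule has_vector_derivative_vector_3)
      (auto intro!: derivative_eq_intros f2 x)
  show "partial2 J (partial1 I X) x y = vector [0, 0, 0]"
    unfolding partial2_def[of J "partial1 I X"]
    by (rule vector_derivative_within_eqI[OF J y _ X1[OF x]], rule has_vector_derivative_vector_3)
      (auto intro!: derivative_eq_intros)
  show "partial2 J (partial2 J X) x y = vector [0, 0, g2 y]"
    unfolding partial2_def[of J "partial2 J X"]
    by (rule vector_derivative_within_eqI[OF J y _ X2], rule has_vector_derivative_vector_3)
      (auto intro!: derivative_eq_intros g2 y)
qed

lemma inner_vector_3:
  "(vector [a, b, c] :: real^3) \<bullet> v = a * v $ 1 + b * v $ 2 + c * v $ 3"
  by (simp add: inner_vec_def sum_3 vector_3)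

lemma curvature_translation_surface:
  assumes I: "nondegenerate_interval I" and J: "nondegenerate_interval J"
    and f1: "\<And>x. x \<in> I \<Longrightarrow> (f has_real_derivative f1 x) (at x within I)"
    and f2: "\<And>x. x \<in> I \<Longrightarrow> (f1 has_real_derivative f2 x) (at x within I)"
    and g1: "\<And>y. y \<in> J \<Longrightarrow> (g has_real_derivative g1 y) (at y within J)"
    and g2: "\<And>y. y \<in> J \<Longrightarrow> (g1 has_real_derivative g2 y) (at y within J)"
    and x: "x \<in> I" and y: "y \<in> J"
  defines "X \<equiv> translation_surface f g" and "W \<equiv> sqrt (1 + (f1 x)\<^sup>2 + (g1 y)\<^sup>2)"
  shows "unit_normal I J X x y = (1 / W) *\<^sub>R vector [- f1 x, - g1 y, 1]"
    and "gauss_curvature I J X x y = f2 x * g2 y / W ^ 4"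
proof -
  note partials = partials_translation_surface[OF I J f1 f2 g1 g2 x y, folded X_def]
  have W: "W > 0" "W\<^sup>2 = 1 + (f1 x)\<^sup>2 + (g1 y)\<^sup>2"
    by (simp_all add: W_def add_pos_nonneg)
  have cross: "cross3 (vector [1, 0, f1 x]) (vector [0, 1, g1 y]) = vector [- f1 x, - g1 y, 1]"
    by (simp add: cross3_def vec_eq_iff forall_3 vector_3)
  have norm: "norm (vector [- f1 x, - g1 y, 1] :: real^3) = W"
    by (simp add: W_def norm_eq_sqrt_inner inner_vector_3 vector_3 power2_eq_square algebra_simps)
  show N: "unit_normal I J X x y = (1 / W) *\<^sub>R vector [- f1 x, - g1 y, 1]"
    by (simp add: unit_normal_def Let_def partials(1,2) cross norm)
  have det: "(1 + f1 x * f1 x) * (1 + g1 y * g1 y) - (f1 x * g1 y)\<^sup>2 = W\<^sup>2"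
    unfolding W(2) by (simp add: power2_eq_square algebra_simps)
  show "gauss_curvature I J X x y = f2 x * g2 y / W ^ 4"
    using W(1)
    by (simp add: gauss_curvature_def Let_def partials N inner_vector_3 vector_3 det)
      (simp add: power2_eq_square power4_eq_xxxx)
qed

text \<open>For the exponent 1/4 the curvature contributes \<open>1 / W\<close>, the same factor as the normal. The
  sign condition on the right-hand side is kept because it makes the passage to the fourth power
  reversible.\<close>

lemma translation_translator_equation:
  assumes I: "nondegenerate_interval I" and J: "nondegenerate_interval J"
    and f1: "\<And>x. x \<in> I \<Longrightarrow> (f has_real_derivative f1 x) (at x within I)"
    and f2: "\<And>x. x \<in> I \<Longrightarrow> (f1 has_real_derivative f2 x) (at x within I)"
    and g1: "\<And>y. y \<in> J \<Longrightarrow> (g has_real_derivative g1 y) (at y within J)"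
    and g2: "\<And>y. y \<in> J \<Longrightarrow> (g1 has_real_derivative g2 y) (at y within J)"
    and translator: "K_translator (1/4) I J (translation_surface f g) v"
    and x: "x \<in> I" and y: "y \<in> J"
  shows "0 \<le> v $ 3 - v $ 1 * f1 x - v $ 2 * g1 y"
    and "f2 x * g2 y = (v $ 3 - v $ 1 * f1 x - v $ 2 * g1 y) ^ 4"
proof -
  define P where "P = v $ 3 - v $ 1 * f1 x - v $ 2 * g1 y"
  define W where "W = sqrt (1 + (f1 x)\<^sup>2 + (g1 y)\<^sup>2)"
  define K where "K = f2 x * g2 y / W ^ 4"
  note curvature = curvature_translation_surface[OF I J f1 f2 g1 g2 x y, folded W_def]
  have W: "W > 0"
    by (simp add: W_def add_pos_nonneg)
  have "0 \<le> K \<and> K powr (1/4) = (- f1 x * v $ 1 + - g1 y * v $ 2 + v $ 3) / W"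
    using translator[unfolded K_translator_def, rule_format, OF x y]
    by (simp add: curvature K_def inner_vector_3)
  then have "0 \<le> K" and eq: "K powr (1/4) = P / W"
    by (simp_all add: P_def algebra_simps)
  have "0 \<le> P / W"
    unfolding eq[symmetric] by simp
  then show "0 \<le> v $ 3 - v $ 1 * f1 x - v $ 2 * g1 y"
    using W by (simp add: P_def zero_le_divide_iff)
  have "K = (K powr (1/4)) ^ 4"
    using \<open>0 \<le> K\<close> by (cases "K = 0") (simp_all flip: powr_realpow add: powr_powr)
  then have "K * W ^ 4 = P ^ 4"
    using W by (simp add: eq power_divide)
  then show "f2 x * g2 y = (v $ 3 - v $ 1 * f1 x - v $ 2 * g1 y) ^ 4"
    using W by (simp add: K_def P_def)
qed

section \<open>Separation of variables\<close>

text \<open>This replaces the usual argument that the mixed derivative of \<open>ln (s - p x - q y)\<close> must vanish: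
  the second difference of the product works for arbitrary functions, also at points where the two
  sides are 0.\<close>

lemma product_eq_fourth_power_of_sum_imp_constant:
  fixes a p :: "'a \<Rightarrow> real" and b q :: "'b \<Rightarrow> real"
  assumes nonneg: "\<And>x y. x \<in> I \<Longrightarrow> y \<in> J \<Longrightarrow> 0 \<le> s - p x - q y"
    and eq: "\<And>x y. x \<in> I \<Longrightarrow> y \<in> J \<Longrightarrow> a x * b y = (s - p x - q y) ^ 4"
  shows "(\<forall>x\<in>I. \<forall>x'\<in>I. p x = p x') \<or> (\<forall>y\<in>J. \<forall>y'\<in>J. q y = q y')"
proof -
  \<comment> \<open>For \<open>P x y = s - p x - q y\<close> this product is \<open>P x y' * P x' y - P x y * P x' y'\<close>.\<close>
  have "(p x - p x') * (q y - q y') = 0"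
    if "x \<in> I" "x' \<in> I" "y \<in> J" "y' \<in> J" for x x' y y'
  proof -
    have "((s - p x - q y) * (s - p x' - q y')) ^ 4 = (a x * b y) * (a x' * b y')"
      using that by (simp add: eq power_mult_distrib)
    also have "\<dots> = (a x * b y') * (a x' * b y)"
      by (simp add: mult_ac)
    also have "\<dots> = ((s - p x - q y') * (s - p x' - q y)) ^ 4"
      using that by (simp add: eq power_mult_distrib)
    finally have "(s - p x - q y) * (s - p x' - q y') = (s - p x - q y') * (s - p x' - q y)"
      using that nonneg by (simp add: power_eq_iff_eq_base)
    then show ?thesis
      by (simp add: algebra_simps)
  qed
  then show ?thesis
    by (metis eq_iff_diff_eq_0 mult_eq_0_iff)
qed

lemma zero_derivative_within_of_constant:
  fixes u :: "real \<Rightarrow> real"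
  assumes "nondegenerate_interval I" and "x \<in> I"
    and "(u has_real_derivative u') (at x within I)" and "\<forall>x\<in>I. \<forall>x'\<in>I. u x = u x'"
  shows "u' = 0"
proof -
  have "vector_derivative u (at x within I) = 0"
  proof (rule vector_derivative_within_eqI[OF assms(1,2)])
    show "((\<lambda>_. u x) has_vector_derivative 0) (at x within I)"
      by simp
    show "u s = u x" if "s \<in> I" for s
      using assms(2,4) that by blast
  qed
  moreover have "vector_derivative u (at x within I) = u'"
    using assms(3) unfolding has_real_derivative_iff_has_vector_derivative
    by (rule vector_derivative_within_eqI[OF assms(1,2)]) simp
  ultimately show ?thesis by simp
qed

section \<open>Integration of the profile equations\<close>

lemma eq_plus_constant_of_same_derivative:
  fixes u w :: "real \<Rightarrow> real"
  assumes "nondegenerate_interval I"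
    and "\<And>x. x \<in> I \<Longrightarrow> (u has_real_derivative d x) (at x within I)"
    and "\<And>x. x \<in> I \<Longrightarrow> (w has_real_derivative d x) (at x within I)"
  obtains c where "\<And>x. x \<in> I \<Longrightarrow> u x = w x + c"
proof -
  have "convex I"
    using assms(1) by (simp add: nondegenerate_interval_def is_interval_convex)
  moreover have "((\<lambda>x. u x - w x) has_real_derivative 0) (at x within I)" if "x \<in> I" for x
    using DERIV_diff[OF assms(2,3)[OF that]] by simp
  ultimately obtain c where "\<And>x. x \<in> I \<Longrightarrow> u x - w x = c"
    using has_field_derivative_zero_constant[of I "\<lambda>x. u x - w x"] by blast
  then have "u x = w x + c" if "x \<in> I" for x
    using that by (metis add.commute diff_add_cancel)
  then show ?thesis by (rule that)
qed

lemma quadratic_of_constant_second_derivative: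
  fixes u :: "real \<Rightarrow> real"
  assumes I: "nondegenerate_interval I"
    and u1: "\<And>x. x \<in> I \<Longrightarrow> (u has_real_derivative u1 x) (at x within I)"
    and u2: "\<And>x. x \<in> I \<Longrightarrow> (u1 has_real_derivative k) (at x within I)"
  obtains a b where "\<And>x. x \<in> I \<Longrightarrow> u x = k * x\<^sup>2 / 2 + a * x + b"
proof -
  obtain a where a: "\<And>x. x \<in> I \<Longrightarrow> u1 x = k * x + a"
    by (rule eq_plus_constant_of_same_derivative[OF I u2, of "\<lambda>x. k * x"])
      (auto intro!: derivative_eq_intros)
  obtain b where "\<And>x. x \<in> I \<Longrightarrow> u x = (k * x\<^sup>2 / 2 + a * x) + b"
    by (rule eq_plus_constant_of_same_derivative[OF I u1, of "\<lambda>x. k * x\<^sup>2 / 2 + a * x"])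
      (auto intro!: derivative_eq_intros simp: a)
  then show ?thesis by (rule that)
qed

text \<open>If \<open>\<Phi>\<close> is a primitive of \<open>\<phi>\<close>, then \<open>u exp (- \<Phi>)\<close> is constant. Only two points are compared, so
  a primitive on the compact segment between them suffices.\<close>

lemma linear_ode_zero_propagates:
  fixes u \<phi> :: "real \<Rightarrow> real"
  assumes I: "is_interval I" and cont: "continuous_on I \<phi>"
    and u': "\<And>t. t \<in> I \<Longrightarrow> (u has_real_derivative \<phi> t * u t) (at t within I)"
    and r: "r \<in> I" and s: "s \<in> I" and zero: "u r = 0"
  shows "u s = 0"
proof -
  define S where "S = {min r s..max r s}"
  have sub: "S \<subseteq> I"
    using I r s unfolding S_def is_interval_1 by (metis atLeastAtMost_iff max_def min_def subsetI)
  have "continuous_on S \<phi>"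
    using cont sub continuous_on_subset by blast
  then obtain \<Phi> where \<Phi>: "\<And>t. t \<in> S \<Longrightarrow> (\<Phi> has_real_derivative \<phi> t) (at t within S)"
    using antiderivative_continuous[of "min r s" "max r s" \<phi>]
    by (auto simp: S_def has_real_derivative_iff_has_vector_derivative)
  have "((\<lambda>t. u t * exp (- \<Phi> t)) has_real_derivative 0) (at t within S)" if t: "t \<in> S" for t
  proof -
    have "(u has_real_derivative \<phi> t * u t) (at t within S)"
      using DERIV_subset[OF u'] sub t by blast
    then show ?thesis
      by (auto intro!: derivative_eq_intros \<Phi>[OF t])
  qed
  then obtain c where c: "\<And>t. t \<in> S \<Longrightarrow> u t * exp (- \<Phi> t) = c"
    using has_field_derivative_zero_constant[of S "\<lambda>t. u t * exp (- \<Phi> t)"]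
    by (auto simp: S_def)
  have "u s * exp (- \<Phi> s) = u r * exp (- \<Phi> r)"
    using c[of r] c[of s] by (simp add: S_def min_def max_def)
  then show ?thesis
    using zero by simp
qed

text \<open>Separating variables requires that \<open>h\<close> has no zeros. The equation is read as the linear one
  \<open>h' = \<phi> h\<close> with the continuous coefficient \<open>\<phi> = - (m/2) h\<^sup>3\<close>, so that a single zero would force
  \<open>h = 0\<close> everywhere. After that \<open>1 / h\<^sup>3\<close> has the constant derivative \<open>3 m / 2\<close>, and is positive.\<close>

lemma quartic_ode_solution:
  fixes h :: "real \<Rightarrow> real"
  assumes J: "nondegenerate_interval J"
    and h': "\<And>y. y \<in> J \<Longrightarrow> (h has_real_derivative - (m / 2) * h y ^ 4) (at y within J)"
    and nonneg: "\<And>y. y \<in> J \<Longrightarrow> 0 \<le> h y"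
    and nonzero: "y0 \<in> J" "h y0 \<noteq> 0"
  obtains c where "\<And>y. y \<in> J \<Longrightarrow> 2 * c + m * y > 0"
    and "\<And>y. y \<in> J \<Longrightarrow> h y = (3/2 * (2 * c + m * y)) powr (- (1/3))"
proof -
  have pos: "h y > 0" if y: "y \<in> J" for y
  proof -
    have "h y \<noteq> 0"
    proof
      assume "h y = 0"
      have "h y0 = 0"
      proof (rule linear_ode_zero_propagates[of J "\<lambda>y. - (m / 2) * h y ^ 3" h, OF _ _ _ y nonzero(1)])
        show "is_interval J"
          using J by (simp add: nondegenerate_interval_def)
        show "continuous_on J (\<lambda>y. - (m / 2) * h y ^ 3)"
          using h' by (intro continuous_intros DERIV_continuous_on)
      qed (use h' \<open>h y = 0\<close> in \<open>simp_all add: power_numeral_reduce mult_ac\<close>)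
      with nonzero(2) show False by simp
    qed
    with nonneg[OF y] show ?thesis by simp
  qed
  have "((\<lambda>y. 1 / h y ^ 3) has_real_derivative 3/2 * m) (at y within J)" if "y \<in> J" for y
    using pos[OF that]
    by (auto intro!: derivative_eq_intros h'[OF that] simp: field_simps power_numeral_reduce)
  then obtain C where C: "\<And>y. y \<in> J \<Longrightarrow> 1 / h y ^ 3 = 3/2 * m * y + C"
    by (rule eq_plus_constant_of_same_derivative[OF J, of _ _ "\<lambda>y. 3/2 * m * y"])
      (auto intro!: derivative_eq_intros)
  \<comment> \<open>The integration constant is rescaled to extract the common factor 3/2.\<close>
  have cube: "1 / h y ^ 3 = 3/2 * (2 * (C/3) + m * y)" if "y \<in> J" for y
    using C[OF that] by (simp add: algebra_simps)
  have "2 * (C/3) + m * y > 0" if "y \<in> J" for y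
  proof -
    have "0 < 1 / h y ^ 3"
      using pos[OF that] by simp
    then show ?thesis
      unfolding cube[OF that] by simp
  qed
  moreover have "h y = (3/2 * (2 * (C/3) + m * y)) powr (- (1/3))" if "y \<in> J" for y
  proof -
    have "(1 / h y ^ 3) powr (- (1/3)) = (h y powr - 3) powr (- (1/3))"
      using pos[OF that] by (simp add: powr_minus_divide)
    also have "\<dots> = h y"
      using pos[OF that] by (simp add: powr_powr)
    finally show ?thesis
      unfolding cube[OF that] by simp
  qed
  ultimately show ?thesis by (rule that)
qed

text \<open>The equation for \<open>g'\<close> is \<open>quartic_ode_solution\<close> for \<open>h = v3 - g'\<close>; one more integration raises the
  exponent from \<open>- 1/3\<close> to \<open>2/3\<close>.\<close>

lemma profile_of_quartic_ode:
  fixes g :: "real \<Rightarrow> real"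
  assumes J: "nondegenerate_interval J" and m: "m \<noteq> 0"
    and g1: "\<And>y. y \<in> J \<Longrightarrow> (g has_real_derivative g1 y) (at y within J)"
    and g2: "\<And>y. y \<in> J \<Longrightarrow> (g1 has_real_derivative m / 2 * (v3 - g1 y) ^ 4) (at y within J)"
    and nonneg: "\<And>y. y \<in> J \<Longrightarrow> 0 \<le> v3 - g1 y"
    and nonzero: "y0 \<in> J" "v3 - g1 y0 \<noteq> 0"
  shows "\<exists>c d. \<forall>y\<in>J. 2 * c + m * y > 0 \<and>
    g y = v3 * (2 * c + m * y) / m - (3/2) powr (2/3) * (2 * c + m * y) powr (2/3) / m + d"
proof -
  have "((\<lambda>y. v3 - g1 y) has_real_derivative - (m / 2) * (v3 - g1 y) ^ 4) (at y within J)"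
    if "y \<in> J" for y
    by (auto intro!: derivative_eq_intros g2[OF that])
  then obtain c where pos: "\<And>y. y \<in> J \<Longrightarrow> 2 * c + m * y > 0"
    and h: "\<And>y. y \<in> J \<Longrightarrow> v3 - g1 y = (3/2 * (2 * c + m * y)) powr (- (1/3))"
    using quartic_ode_solution[where h = "\<lambda>y. v3 - g1 y", OF J _ nonneg nonzero] by blast
  define G where "G y = v3 * (2 * c + m * y) / m - (3/2) powr (2/3) * (2 * c + m * y) powr (2/3) / m"
    for y
  have G: "(G has_real_derivative g1 y) (at y within J)" if y: "y \<in> J" for y
  proof -
    define z where "z = 2 * c + m * y"
    have z: "z > 0"
      using pos[OF y] by (simp add: z_def)
    \<comment> \<open>The constants agree because the exponents 2/3 and -1/3 of 3/2 differ by 1.\<close>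
    have const: "(3/2::real) powr (2/3) * (2/3) = (3/2) powr (- (1/3))"
      using powr_add[of "3/2::real" 1 "- (1/3)"] by simp
    have "g1 y = v3 - (3/2 * z) powr (- (1/3))"
      using h[OF y] by (simp add: z_def)
    also have "(3/2 * z) powr (- (1/3)) = (3/2) powr (2/3) * (2/3) * z powr (- (1/3))"
      unfolding const by (rule powr_mult)
    finally have g1_eq: "g1 y = v3 - (3/2) powr (2/3) * (2/3 * z powr (- (1/3)))"
      by (simp only: mult.assoc)
    have "((\<lambda>y. (2 * c + m * y) powr (2/3)) has_real_derivative
        2/3 * z powr (- (1/3)) * m) (at y within J)"
      using pos[OF y] unfolding z_def
      by (auto intro!: derivative_eq_intros)
    then have "((\<lambda>y. v3 * (2 * c + m * y) / m - (3/2) powr (2/3) * (2 * c + m * y) powr (2/3) / m)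
      has_real_derivative v3 * m / m - (3/2) powr (2/3) * (2/3 * z powr (- (1/3)) * m) / m) (at y within J)"
      by (intro DERIV_diff DERIV_cdivide DERIV_cmult) (auto intro!: derivative_eq_intros)
    then show ?thesis
      using m by (simp add: g1_eq G_def[abs_def] mult_ac)
  qed
  obtain d where "\<And>y. y \<in> J \<Longrightarrow> g y = G y + d"
    using eq_plus_constant_of_same_derivative[OF J g1 G] by blast
  then show ?thesis
    using pos unfolding G_def by blast
qed

text \<open>The translator equation enters only in its separated form, which is symmetric under exchange of
  the two profiles. So this lemma serves for either role of \<open>f\<close> and \<open>g\<close>, without computing the
  curvature of the surface with interchanged profiles. One point of nonzero curvature gives \<open>m\<close> and
  excludes the solution \<open>v3 - g' = 0\<close>.\<close>

lemma profiles_of_speed_orthogonal_to_first_axis: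
  fixes f g :: "real \<Rightarrow> real" and w :: "real^3"
  assumes I: "nondegenerate_interval I" and J: "nondegenerate_interval J"
    and f1: "\<And>x. x \<in> I \<Longrightarrow> (f has_real_derivative f1 x) (at x within I)"
    and f2: "\<And>x. x \<in> I \<Longrightarrow> (f1 has_real_derivative f2 x) (at x within I)"
    and g1: "\<And>y. y \<in> J \<Longrightarrow> (g has_real_derivative g1 y) (at y within J)"
    and g2: "\<And>y. y \<in> J \<Longrightarrow> (g1 has_real_derivative g2 y) (at y within J)"
    and nonneg: "\<And>y. y \<in> J \<Longrightarrow> 0 \<le> w $ 3 - w $ 2 * g1 y"
    and eq: "\<And>x y. x \<in> I \<Longrightarrow> y \<in> J \<Longrightarrow> f2 x * g2 y = (w $ 3 - w $ 2 * g1 y) ^ 4"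
    and nonflat: "x0 \<in> I" "y0 \<in> J" "f2 x0 * g2 y0 \<noteq> 0"
  shows "w \<noteq> 0 \<and>
     (\<exists>a b m. m \<noteq> 0 \<and>
        (\<forall>x\<in>I. f x = x\<^sup>2 / m + a * x + b) \<and>
        (w = vector [0, 0, 1] \<longrightarrow>
           (\<exists>c d. \<forall>y\<in>J. g y = m * y\<^sup>2 / 4 + c * y + d)) \<and>
        (\<forall>v3. w = vector [0, 1, v3] \<longrightarrow>
           (\<exists>c d. \<forall>y\<in>J. 2 * c + m * y > 0 \<and>
              g y = v3 * (2 * c + m * y) / m
                    - (3/2) powr (2/3) * (2 * c + m * y) powr (2/3) / m + d)))"
proof -
  have P0: "w $ 3 - w $ 2 * g1 y0 \<noteq> 0"
    using eq[OF nonflat(1,2)] nonflat(3) by auto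
  define m where "m = 2 / f2 x0"
  have m: "m \<noteq> 0"
    using nonflat(3) by (simp add: m_def)
  have f2_eq: "f2 x = 2 / m" if "x \<in> I" for x
  proof -
    have "f2 x * g2 y0 = f2 x0 * g2 y0"
      using eq[OF that nonflat(2)] eq[OF nonflat(1,2)] by simp
    then show ?thesis
      using nonflat(3) by (simp add: m_def)
  qed
  have g2_eq: "g2 y = m / 2 * (w $ 3 - w $ 2 * g1 y) ^ 4" if "y \<in> J" for y
    using eq[OF nonflat(1) that] f2_eq[OF nonflat(1)] m by (simp add: field_simps)
  have f2': "(f1 has_real_derivative 2 / m) (at x within I)" if "x \<in> I" for x
    using f2[OF that] f2_eq[OF that] by simp
  have g2': "(g1 has_real_derivative m / 2 * (w $ 3 - w $ 2 * g1 y) ^ 4) (at y within J)"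
    if "y \<in> J" for y
    using g2[OF that] g2_eq[OF that] by simp
  obtain a b where "\<And>x. x \<in> I \<Longrightarrow> f x = 2 / m * x\<^sup>2 / 2 + a * x + b"
    using quadratic_of_constant_second_derivative[OF I f1 f2'] by blast
  then have f: "\<forall>x\<in>I. f x = x\<^sup>2 / m + a * x + b"
    by simp
  have case1: "\<exists>c d. \<forall>y\<in>J. g y = m * y\<^sup>2 / 4 + c * y + d" if "w = vector [0, 0, 1]"
  proof -
    have "(g1 has_real_derivative m / 2) (at y within J)" if "y \<in> J" for y
      using g2'[OF that] \<open>w = vector [0, 0, 1]\<close> by (simp add: vector_3)
    then obtain c d where "\<And>y. y \<in> J \<Longrightarrow> g y = m / 2 * y\<^sup>2 / 2 + c * y + d"
      using quadratic_of_constant_second_derivative[OF J g1] by blast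
    then show ?thesis
      by (intro exI[of _ c] exI[of _ d]) simp
  qed
  have case2: "\<exists>c d. \<forall>y\<in>J. 2 * c + m * y > 0 \<and>
      g y = v3 * (2 * c + m * y) / m - (3/2) powr (2/3) * (2 * c + m * y) powr (2/3) / m + d"
    if "w = vector [0, 1, v3]" for v3
    using profile_of_quartic_ode[OF J m g1, of v3] g2' nonneg nonflat(2) P0 that
    by (simp add: vector_3)
  have "w \<noteq> 0"
    using P0 by auto
  then show ?thesis
    using m f case1 case2 by blast
qed

section \<open>Classification of the translators\<close>

(* (F, A, w) and G, B are f, I, v and g, J, possibly with the roles of f and g interchanged, which
   also interchanges the first two components of the speed. The conclusion w $ 1 = 0, w \<noteq> 0 says
   that, after this interchange, the speed is (0,0,v3) or (0,v2,v3) with v2 \<noteq> 0; up to the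
   normalization of the speed these are the cases (1) and (2). The positivity of 2 c + m y makes
   the real power (2 c + m y) powr (2/3) meaningful. *)
theorem theorem4p1:
  fixes f g :: "real \<Rightarrow> real" and I J :: "real set" and v :: "real^3"
  assumes "nondegenerate_interval I" and "nondegenerate_interval J"
    and "smooth_fun_on f I" and "smooth_fun_on g J"
    and "K_translator (1/4) I J (translation_surface f g) v"
    and "\<not> (\<exists>k. \<forall>x\<in>I. \<forall>y\<in>J. gauss_curvature I J (translation_surface f g) x y = k)"
  shows "\<exists>F G A B w.
     ((F, G, A, B, w) = (f, g, I, J, v) \<or>
      (F, G, A, B, w) = (g, f, J, I, vector [v $ 2, v $ 1, v $ 3])) \<and>
     w $ 1 = 0 \<and> w \<noteq> 0 \<and>
     (\<exists>a b m. m \<noteq> 0 \<and>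
        (\<forall>x\<in>A. F x = x\<^sup>2 / m + a * x + b) \<and>
        (w = vector [0, 0, 1] \<longrightarrow>
           (\<exists>c d. \<forall>y\<in>B. G y = m * y\<^sup>2 / 4 + c * y + d)) \<and>
        (\<forall>v3. w = vector [0, 1, v3] \<longrightarrow>
           (\<exists>c d. \<forall>y\<in>B. 2 * c + m * y > 0 \<and>
              G y = v3 * (2 * c + m * y) / m
                    - (3/2) powr (2/3) * (2 * c + m * y) powr (2/3) / m + d)))"
proof -
  note I = assms(1) and J = assms(2)
  have derivatives: "\<exists>u1 u2. (\<forall>x\<in>S. (u has_real_derivative u1 x) (at x within S)) \<and>
      (\<forall>x\<in>S. (u1 has_real_derivative u2 x) (at x within S))"
    if smooth: "smooth_fun_on u S" for u S
  proof -
    obtain D where D0: "\<And>x. x \<in> S \<Longrightarrow> D 0 x = u x"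
      and D: "\<And>n x. x \<in> S \<Longrightarrow> (D n has_real_derivative D (Suc n) x) (at x within S)"
      using smooth unfolding smooth_fun_on_def by blast
    have "(u has_real_derivative D 1 x) (at x within S)" if "x \<in> S" for x
      using has_derivative_transform[OF that, of u "D 0"] D[OF that, of 0] D0
      by (simp add: has_field_derivative_def)
    then show ?thesis
      using D[of _ 1] by blast
  qed
  from derivatives[OF assms(3)] obtain f1 f2
    where f1: "\<And>x. x \<in> I \<Longrightarrow> (f has_real_derivative f1 x) (at x within I)"
      and f2: "\<And>x. x \<in> I \<Longrightarrow> (f1 has_real_derivative f2 x) (at x within I)"
    by blast
  from derivatives[OF assms(4)] obtain g1 g2
    where g1: "\<And>y. y \<in> J \<Longrightarrow> (g has_real_derivative g1 y) (at y within J)"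
      and g2: "\<And>y. y \<in> J \<Longrightarrow> (g1 has_real_derivative g2 y) (at y within J)"
    by blast
  have translator: "0 \<le> v $ 3 - v $ 1 * f1 x - v $ 2 * g1 y"
    "f2 x * g2 y = (v $ 3 - v $ 1 * f1 x - v $ 2 * g1 y) ^ 4" if "x \<in> I" "y \<in> J" for x y
    by (rule translation_translator_equation[OF I J f1 f2 g1 g2 assms(5) that]; assumption)+
  \<comment> \<open>Identically vanishing curvature would be constant.\<close>
  obtain x0 y0 where nonflat: "x0 \<in> I" "y0 \<in> J" "f2 x0 * g2 y0 \<noteq> 0"
    using assms(6) curvature_translation_surface(2)[OF I J f1 f2 g1 g2]
    by (metis div_0)
  have "v $ 1 = 0 \<or> v $ 2 = 0"
  proof (rule ccontr)
    assume neq: "\<not> (v $ 1 = 0 \<or> v $ 2 = 0)"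
    have "(\<forall>x\<in>I. \<forall>x'\<in>I. v $ 1 * f1 x = v $ 1 * f1 x') \<or> (\<forall>y\<in>J. \<forall>y'\<in>J. v $ 2 * g1 y = v $ 2 * g1 y')"
      using translator by (rule product_eq_fourth_power_of_sum_imp_constant)
    then have "f2 x0 = 0 \<or> g2 y0 = 0"
      using neq zero_derivative_within_of_constant[OF I nonflat(1) f2[OF nonflat(1)]]
        zero_derivative_within_of_constant[OF J nonflat(2) g2[OF nonflat(2)]]
      by auto
    with nonflat(3) show False by simp
  qed
  then show ?thesis
  proof
    assume v1: "v $ 1 = 0"
    have P: "0 \<le> v $ 3 - v $ 2 * g1 y" "f2 x * g2 y = (v $ 3 - v $ 2 * g1 y) ^ 4"
      if "x \<in> I" "y \<in> J" for x y
      using translator[OF that] v1 by simp_all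
    note profiles = profiles_of_speed_orthogonal_to_first_axis[OF I J f1 f2 g1 g2
        P(1)[OF nonflat(1)] P(2) nonflat]
    show ?thesis
      by (rule exI[of _ f], rule exI[of _ g], rule exI[of _ I], rule exI[of _ J], rule exI[of _ v])
        (intro conjI disjI1 refl v1 conjunct1[OF profiles] conjunct2[OF profiles])
  next
    assume v2: "v $ 2 = 0"
    define w :: "real^3" where "w = vector [v $ 2, v $ 1, v $ 3]"
    have w: "w $ 1 = 0" "w $ 2 = v $ 1" "w $ 3 = v $ 3"
      by (simp_all add: w_def vector_3 v2)
    have P: "0 \<le> w $ 3 - w $ 2 * f1 x" "g2 y * f2 x = (w $ 3 - w $ 2 * f1 x) ^ 4"
      if "y \<in> J" "x \<in> I" for x y
      using translator[OF that(2,1)] v2 by (simp_all add: w mult.commute)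
    have nonflat': "g2 y0 * f2 x0 \<noteq> 0"
      using nonflat(3) by simp
    note profiles = profiles_of_speed_orthogonal_to_first_axis[OF J I g1 g2 f1 f2
        P(1)[OF nonflat(2)] P(2) nonflat(2,1) nonflat']
    show ?thesis
      unfolding w_def[symmetric]
      by (rule exI[of _ g], rule exI[of _ f], rule exI[of _ J], rule exI[of _ I], rule exI[of _ w])
        (intro conjI disjI2 refl w(1) conjunct1[OF profiles] conjunct2[OF profiles])
  qed
qed

end
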